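(* Let $\ell \ge 2$ and $d\ge 2$ be integers. If there exists a compact set $K \subseteq [0,1]^d$ that intersects each $(d-1)$-dimensional affine subspace (i.e. hyperplane) of $\mathbb{R}^d$ that meets $[0,1]^d$ and whose $\ell$-fold sumset $\ell K$ is nowhere dense in $\mathbb{R}^d$, then there exists a compact set $K' \subseteq [0,1]^{d+1}$ that intersects each $d$-dimensional affine subspace (i.e. hyperplane) of $\mathbb{R}^{d+1}$ that meets $[0,1]^{d+1}$ and whose $(\ell+1)$-fold sumset $(\ell+1)K'$ is nowhere dense in $\mathbb{R}^{d+1}$.
   Context: For a positive integer $m$ and a subset $A$ of a Euclidean space, the $m$-fold sumset is $mA = \{a_1+\dots+a_m : a_1,\dots,a_m\in A\}$ (not the dilate of $A$ by $m$). *)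

theory Defs
  imports "HOL-Analysis.Analysis"
begin

definition unit_cube :: "(real ^ 'n) set" where
  "unit_cube = {x. \<forall>i. 0 \<le> x $ i \<and> x $ i \<le> 1}"

(* The m summands may repeat; this is not the dilate of A by m. *)
definition sumset :: "nat \<Rightarrow> 'a::comm_monoid_add set \<Rightarrow> 'a set" where
  "sumset m A = {\<Sum>i<m. a i | a. \<forall>i<m. a i \<in> A}"

definition nowhere_dense :: "'a::topological_space set \<Rightarrow> bool" where
  "nowhere_dense S \<longleftrightarrow> interior (closure S) = {}"

(* aff_dim is int-valued with aff_dim {} = -1, so the codimension is expressed in int. *)
definition is_hyperplane :: "(real ^ 'n) set \<Rightarrow> bool" where
  "is_hyperplane H \<longleftrightarrow> affine H \<and> aff_dim H = int CARD('n) - 1"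

definition meets_hyperplanes_of_cube :: "(real ^ 'n) set \<Rightarrow> bool" where
  "meets_hyperplanes_of_cube K \<longleftrightarrow>
     (\<forall>H. is_hyperplane H \<and> H \<inter> unit_cube \<noteq> {} \<longrightarrow> K \<inter> H \<noteq> {})"

end

theory Submission
  imports Defs
begin

text \<open>
  Fix \<open>p \<in> K\<close> and let \<open>K'\<close> consist of the two copies \<open>K \<times> {0, 1}\<close> of \<open>K\<close> in the bottom and top
  faces together with the vertical segment \<open>{p} \<times> [0, 1]\<close>. A hyperplane that meets the cube but
  neither of these two faces separates them, so it crosses the segment; if it meets one of the
  faces and is not horizontal, it meets the copy of \<open>K\<close> there. A sum of \<open>l + 1\<close> points of \<open>K'\<close>
  either has integral height, or one of its summands lies on the segment, and then its projection
  lies in \<open>p + l K\<close>. Hence the sumset is covered by two closed sets with empty interior.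
\<close>

section \<open>Preliminaries on sumsets, hyperplanes and empty interiors\<close>

text \<open>Frees the sumset from the index set \<open>{..<m}\<close>: removing one summand leaves
  an index set with a gap.\<close>

lemma sum_in_sumset:
  assumes "finite I" "card I = m" "\<And>i. i \<in> I \<Longrightarrow> f i \<in> A"
  shows "sum f I \<in> sumset m A"
proof -
  obtain h where h: "bij_betw h {0..<m} I"
    using ex_bij_betw_nat_finite assms(1,2) by blast
  have "sum f I = (\<Sum>i<m. f (h i))"
    using sum.reindex_bij_betw[OF h, of f] by (simp add: atLeast0LessThan)
  moreover have "\<forall>i<m. f (h i) \<in> A"
    using h assms(3) by (auto simp: bij_betw_def)
  ultimately show ?thesis
    unfolding sumset_def by blast
qed

lemma is_hyperplane_normal:
  fixes H :: "(real ^ 'n) set"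
  assumes "is_hyperplane H"
  obtains a b where "a \<noteq> 0" "H = {x. a \<bullet> x = b}"
  using assms aff_dim_eq_hyperplane[of H]
  by (auto simp: is_hyperplane_def affine_hull_eq[THEN iffD2])

lemma is_hyperplane_level_set:
  fixes a :: "real ^ 'n"
  assumes "a \<noteq> 0"
  shows "is_hyperplane {x. a \<bullet> x = b}"
  using assms by (simp add: is_hyperplane_def affine_hyperplane aff_dim_hyperplane)

lemma convex_unit_cube: "convex (unit_cube :: (real ^ 'n) set)"
proof -
  have "unit_cube = cbox (0 :: real ^ 'n) 1"
    by (auto simp: unit_cube_def mem_box_cart)
  then show ?thesis
    using convex_box by metis
qed

text \<open>Intermediate value theorem: a convex set is connected, so a linear functional that
  misses \<open>b\<close> on it stays on one side of \<open>b\<close>.\<close>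

lemma inner_avoids_value_on_convex:
  fixes a :: "'a::real_inner"
  assumes "convex S" "x \<in> S" "y \<in> S" "\<And>z. z \<in> S \<Longrightarrow> a \<bullet> z \<noteq> b"
  shows "a \<bullet> x < b \<longleftrightarrow> a \<bullet> y < b"
proof -
  have "connected S"
    using assms(1) by (rule convex_connected)
  then have "a \<bullet> u \<ge> b" if "u \<in> S" "v \<in> S" "a \<bullet> v > b" for u v
    using connected_ivt_hyperplane[of S u v a b] that assms(4) by fastforce
  then show ?thesis
    using assms(2-4) by (metis linorder_neqE not_le)
qed

lemma nowhere_dense_subset_Un:
  assumes "S \<subseteq> A \<union> B" "closed A" "closed B" "interior A = {}" "interior B = {}"
  shows "nowhere_dense S"
proof -
  have "closure S \<subseteq> A \<union> B"
    using assms(1-3) by (intro closure_minimal closed_Un)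
  then have "interior (closure S) \<subseteq> interior (A \<union> B)"
    by (rule interior_mono)
  then show ?thesis
    using interior_closed_Un_empty_interior[OF assms(2,5)] assms(4)
    by (simp add: nowhere_dense_def)
qed

text \<open>The integers are countable, a nonempty open set of reals is not.\<close>

lemma interior_Ints_real: "interior (\<int> :: real set) = {}"
proof (rule ccontr)
  assume "interior (\<int> :: real set) \<noteq> {}"
  then have "\<exists>x \<in> interior (\<int> :: real set). x \<notin> \<int>"
    by (rule open_minus_countable[OF countable_int _ open_interior])
  then show False
    using interior_subset[of "\<int> :: real set"] by blast
qed

text \<open>The coordinate \<open>t\<close> is the height; \<open>g\<close> enumerates the remaining coordinates.\<close>

locale height_coordinate =
  fixes t :: "'m::finite" and g :: "'n::finite \<Rightarrow> 'm"
  assumes inj_g: "inj g" and range_g: "range g = - {t}"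
begin

definition proj :: "real ^ 'm \<Rightarrow> real ^ 'n" where
  "proj z = (\<chi> i. z $ g i)"

abbreviation height :: "real ^ 'm \<Rightarrow> real" where
  "height z \<equiv> z $ t"

definition lift :: "real ^ 'n \<Rightarrow> real \<Rightarrow> real ^ 'm" where
  "lift x s = (\<chi> j. if j = t then s else x $ inv g j)"

lemma g_neq [simp]: "g i \<noteq> t"
  using range_g by blast

lemma coordinate_cases:
  obtains "j = t" | i where "j = g i"
  using range_g by blast

lemma proj_lift [simp]: "proj (lift x s) = x"
  by (simp add: proj_def lift_def inv_f_f[OF inj_g] vec_eq_iff)

lemma lift_height [simp]: "lift x s $ t = s"
  by (simp add: lift_def)

lemma lift_g [simp]: "lift x s $ g i = x $ i"
  by (simp add: lift_def inv_f_f[OF inj_g])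

lemma lift_proj [simp]: "lift (proj z) (z $ t) = z"
proof -
  have "lift (proj z) (z $ t) $ j = z $ j" for j
    by (cases j rule: coordinate_cases) (auto simp: proj_def)
  then show ?thesis
    by (simp add: vec_eq_iff)
qed

lemma continuous_on_proj: "continuous_on S proj"
  unfolding proj_def by (intro continuous_intros)

lemma continuous_on_lift:
  assumes "continuous_on S f" "continuous_on S h"
  shows "continuous_on S (\<lambda>u. lift (f u) (h u))"
proof -
  have "continuous_on S (\<lambda>u. if j = t then h u else f u $ inv g j)" for j
    using assms by (cases "j = t") (auto intro!: continuous_intros)
  then show ?thesis
    unfolding lift_def by (intro continuous_intros)
qed

lemma proj_sum: "proj (sum f I) = (\<Sum>i\<in>I. proj (f i))"
  by (simp add: proj_def vec_eq_iff)

text \<open>Turns membership of a lifted point in a hyperplane into an equation that is affine in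
  \<open>x\<close> and in \<open>s\<close>.\<close>

lemma inner_lift: "a \<bullet> lift x s = proj a \<bullet> x + a $ t * s"
proof -
  have "a \<bullet> lift x s = a $ t * s + (\<Sum>j\<in>range g. a $ j * lift x s $ j)"
    by (simp add: inner_vec_def range_g sum.remove[of UNIV t] Compl_eq_Diff_UNIV)
  also have "(\<Sum>j\<in>range g. a $ j * lift x s $ j) = proj a \<bullet> x"
    by (simp add: sum.reindex[OF inj_g] inner_vec_def proj_def)
  finally show ?thesis
    by simp
qed

lemma lift_in_unit_cube: "lift x s \<in> unit_cube \<longleftrightarrow> x \<in> unit_cube \<and> 0 \<le> s \<and> s \<le> 1"
  unfolding unit_cube_def mem_Collect_eq
  by (metis coordinate_cases lift_g lift_height)

text \<open>The horizontal slice of the interior through \<open>z\<close> is open in the base,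
  contains \<open>proj z\<close> and lies in \<open>C\<close>.\<close>

lemma interior_proj_vimage:
  assumes "interior C = {}"
  shows "interior (proj -` C) = {}"
proof (rule ccontr)
  assume "interior (proj -` C) \<noteq> {}"
  then obtain z where z: "z \<in> interior (proj -` C)"
    by blast
  let ?V = "(\<lambda>x. lift x (z $ t)) -` interior (proj -` C)"
  have "open ?V"
    by (intro open_vimage open_interior continuous_on_lift continuous_intros)
  moreover have "?V \<subseteq> C"
    using interior_subset[of "proj -` C"] by auto
  ultimately have "?V \<subseteq> interior C"
    by (simp add: interior_maximal)
  then show False
    using z assms by (metis empty_iff lift_proj subset_iff vimageI)
qed

text \<open>The same slicing argument along the vertical line through \<open>z\<close>.\<close>

lemma interior_height_vimage:
  assumes "interior C = {}"
  shows "interior (height -` C) = {}"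
proof (rule ccontr)
  assume "interior (height -` C) \<noteq> {}"
  then obtain z where z: "z \<in> interior (height -` C)"
    by blast
  let ?V = "(\<lambda>s. lift (proj z) s) -` interior (height -` C)"
  have "open ?V"
    by (intro open_vimage open_interior continuous_on_lift continuous_intros)
  moreover have "?V \<subseteq> C"
    using interior_subset[of "height -` C"] by auto
  ultimately have "?V \<subseteq> interior C"
    by (simp add: interior_maximal)
  then show False
    using z assms by (metis empty_iff lift_proj subset_iff vimageI)
qed

section \<open>The set K' and its properties\<close>

definition suspend :: "real ^ 'n \<Rightarrow> (real ^ 'n) set \<Rightarrow> (real ^ 'm) set" where
  "suspend p K = (\<lambda>x. lift x 0) ` K \<union> (\<lambda>x. lift x 1) ` K \<union> lift p ` {0..1}"

lemma suspendI:
  "x \<in> K \<Longrightarrow> e = 0 \<or> e = 1 \<Longrightarrow> lift x e \<in> suspend p K"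
  "0 \<le> s \<Longrightarrow> s \<le> 1 \<Longrightarrow> lift p s \<in> suspend p K"
  by (auto simp: suspend_def)

lemma compact_suspend:
  assumes "compact K"
  shows "compact (suspend p K)"
  unfolding suspend_def using assms
  by (intro compact_Un compact_continuous_image continuous_on_lift continuous_intros) auto

lemma suspend_subset_unit_cube:
  assumes "K \<subseteq> unit_cube" "p \<in> K"
  shows "suspend p K \<subseteq> unit_cube"
  using assms by (auto simp: suspend_def lift_in_unit_cube)

lemma meets_hyperplanes_suspend:
  assumes "K \<subseteq> unit_cube" "p \<in> K" "meets_hyperplanes_of_cube K"
  shows "meets_hyperplanes_of_cube (suspend p K)"
  unfolding meets_hyperplanes_of_cube_def
proof (intro allI impI, elim conjE)
  fix H :: "(real ^ 'm) set"
  assume "is_hyperplane H" and meets: "H \<inter> unit_cube \<noteq> {}"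
  from \<open>is_hyperplane H\<close> obtain a b where a: "a \<noteq> 0" and H: "H = {x. a \<bullet> x = b}"
    by (rule is_hyperplane_normal)
  have lift_H: "lift x s \<in> H \<longleftrightarrow> proj a \<bullet> x + a $ t * s = b" for x s
    by (simp add: H inner_lift)
  obtain z where z: "z \<in> H" "z \<in> unit_cube"
    using meets by blast
  define x s where "x = proj z" and "s = z $ t"
  have xs: "lift x s \<in> H" "lift x s \<in> unit_cube"
    using z by (simp_all add: x_def s_def)
  then have x: "x \<in> unit_cube" and s: "0 \<le> s" "s \<le> 1"
    by (simp_all add: lift_in_unit_cube)
  have p: "p \<in> unit_cube"
    using assms by blast
  show "suspend p K \<inter> H \<noteq> {}"
  \<comment> \<open>A vanishing \<open>proj a\<close> means that \<open>H\<close> is horizontal; it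
    then meets the segment at the height of \<open>z\<close>.\<close>
  proof (cases "proj a = 0")
    case True
    then have "lift p s \<in> H"
      using xs(1) by (simp add: lift_H)
    then show ?thesis
      using s suspendI by blast
  next
    case False
    show ?thesis
    proof (cases "\<exists>e\<in>{0,1}. \<exists>y\<in>unit_cube. lift y e \<in> H")
      case True
      then obtain e y where e: "e = 0 \<or> e = 1" and y: "y \<in> unit_cube" "lift y e \<in> H"
        by blast
      \<comment> \<open>Since \<open>proj a\<close> is nonzero, the slice of \<open>H\<close> at
        height \<open>e\<close> is a hyperplane of the base; it meets the cube at \<open>y\<close>,
        hence it meets \<open>K\<close>.\<close>
      have "\<exists>k\<in>K. proj a \<bullet> k = b - a $ t * e"
        using assms(3) is_hyperplane_level_set[OF False, of "b - a $ t * e"] y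
        unfolding meets_hyperplanes_of_cube_def lift_H by force
      then obtain k where "k \<in> K" "lift k e \<in> H"
        by (auto simp: lift_H)
      then show ?thesis
        using e suspendI by blast
    next
      case False
      \<comment> \<open>These are the values of the functional z \<mapsto> a \<bullet> z - b at the
        bottom and top ends of the segment over \<open>p\<close>; \<open>u'\<close> and
        \<open>v'\<close> are those over \<open>x\<close>.\<close>
      define u v where "u = proj a \<bullet> p - b" and "v = u + a $ t"
      define u' v' where "u' = proj a \<bullet> x - b" and "v' = u' + a $ t"
      have avoid: "proj a \<bullet> y \<noteq> b" "proj a \<bullet> y \<noteq> b - a $ t" if "y \<in> unit_cube" for y
        using False that by (auto simp: lift_H)
      \<comment> \<open>On each face the functional has no zero, so its sign over \<open>p\<close>
        is its sign over \<open>x\<close>.\<close>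
      have signs: "u < 0 \<longleftrightarrow> u' < 0" "v < 0 \<longleftrightarrow> v' < 0"
        using inner_avoids_value_on_convex[OF convex_unit_cube p x avoid(1)]
          inner_avoids_value_on_convex[OF convex_unit_cube p x avoid(2)]
        by (simp_all add: u_def u'_def v_def v'_def less_diff_eq algebra_simps)
      have nz: "u \<noteq> 0" "v \<noteq> 0" "u' \<noteq> 0" "v' \<noteq> 0"
        using avoid[OF p] avoid[OF x] by (auto simp: u_def u'_def v_def v'_def)
      have mix: "(1 - s) * u' + s * v' = 0"
        using xs(1) by (simp add: lift_H u'_def v'_def algebra_simps)
      \<comment> \<open>Otherwise \<open>mix\<close> would write 0 as a convex combination of two
        numbers of the same strict sign.\<close>
      have "\<not> (u' < 0 \<and> v' < 0)" "\<not> (u' > 0 \<and> v' > 0)"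
        using mix s convex_bound_lt[of u' 0 v' "1 - s" s]
          convex_bound_lt[of "- u'" 0 "- v'" "1 - s" s] by auto
      then have opp: "u < 0 \<and> v > 0 \<or> u > 0 \<and> v < 0"
        using signs nz by linarith
      \<comment> \<open>The zero of the affine function r \<mapsto> u + r * (v - u), that is, the
        height at which the segment crosses \<open>H\<close>.\<close>
      define r where "r = u / (u - v)"
      have "0 \<le> r" "r \<le> 1"
        using opp by (auto simp: r_def field_simps)
      moreover have "r * (u - v) = u"
        using opp by (auto simp: r_def)
      then have "lift p r \<in> H"
        by (simp add: lift_H v_def u_def algebra_simps)
      ultimately show ?thesis
        using suspendI by blast
    qed
  qed
qed

lemma nowhere_dense_sumset_suspend:
  assumes "p \<in> K" "nowhere_dense (sumset l K)"
  shows "nowhere_dense (sumset (l + 1) (suspend p K))"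
proof -
  \<comment> \<open>The closure makes \<open>C\<close> closed, and its interior is empty because
    translation preserves interiors.\<close>
  define C where "C = (+) p ` closure (sumset l K)"
  have "sumset (l + 1) (suspend p K) \<subseteq> proj -` C \<union> height -` \<int>"
  proof
    fix z assume "z \<in> sumset (l + 1) (suspend p K)"
    then obtain a where z: "z = (\<Sum>i<l+1. a i)" and a: "\<And>i. i < l + 1 \<Longrightarrow> a i \<in> suspend p K"
      unfolding sumset_def by blast
    have proj_a: "proj (a i) \<in> K" if "i < l + 1" for i
      using a[OF that] assms(1) by (auto simp: suspend_def)
    show "z \<in> proj -` C \<union> height -` \<int>"
    proof (cases "\<forall>i<l+1. a i $ t \<in> \<int>")
      case True
      then have "z $ t \<in> \<int>"
        unfolding z by (auto simp del: sum.lessThan_Suc intro!: Ints_sum)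
      then show ?thesis
        by simp
    next
      case False
      then obtain k where k: "k < l + 1" "a k $ t \<notin> \<int>"
        by blast
      \<comment> \<open>A non-integral height excludes the copies of \<open>K\<close> at heights 0
        and 1, so \<open>a k\<close> lies on the segment.\<close>
      then have "proj (a k) = p"
        using a[OF k(1)] by (auto simp: suspend_def)
      then have "proj z = p + (\<Sum>i\<in>{..<l+1}-{k}. proj (a i))"
        unfolding z proj_sum using k(1)
        by (subst sum.remove[of _ k]) auto
      moreover have "(\<Sum>i\<in>{..<l+1}-{k}. proj (a i)) \<in> sumset l K"
        using k(1) proj_a by (intro sum_in_sumset) auto
      ultimately have "proj z \<in> C"
        unfolding C_def using closure_subset by blast
      then show ?thesis
        by simp
    qed
  qed
  moreover have "closed (proj -` C)"
    unfolding C_def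
    by (intro closed_vimage closed_translation closed_closure continuous_on_proj)
  moreover have "closed (height -` \<int>)"
    by (intro closed_vimage closed_Ints continuous_intros)
  moreover have "interior C = {}"
    using assms(2) by (simp add: C_def interior_translation nowhere_dense_def)
  then have "interior (proj -` C) = {}"
    by (rule interior_proj_vimage)
  moreover have "interior (height -` \<int>) = {}"
    using interior_Ints_real by (rule interior_height_vimage)
  ultimately show ?thesis
    by (rule nowhere_dense_subset_Un)
qed

end

theorem theorem7p1:
  fixes l d :: nat
  assumes "l \<ge> 2" and "d \<ge> 2"
    and "CARD('n::finite) = d" and "CARD('m::finite) = d + 1"
    and "\<exists>K :: (real ^ 'n) set. compact K \<and> K \<subseteq> unit_cube \<and>
           meets_hyperplanes_of_cube K \<and> nowhere_dense (sumset l K)"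
  shows "\<exists>K' :: (real ^ 'm) set. compact K' \<and> K' \<subseteq> unit_cube \<and>
           meets_hyperplanes_of_cube K' \<and> nowhere_dense (sumset (l + 1) K')"
proof -
  obtain K :: "(real ^ 'n) set" where K: "compact K" "K \<subseteq> unit_cube"
      "meets_hyperplanes_of_cube K" "nowhere_dense (sumset l K)"
    using assms(5) by blast
  \<comment> \<open>Here \<open>1\<close> is the all-ones vector. This hyperplane touches the cube
    at the origin, which forces \<open>K\<close> to be nonempty.\<close>
  have "is_hyperplane {x :: real ^ 'n. 1 \<bullet> x = 0}"
    by (rule is_hyperplane_level_set) simp
  moreover have "0 \<in> {x :: real ^ 'n. 1 \<bullet> x = 0} \<inter> unit_cube"
    by (simp add: unit_cube_def)
  ultimately obtain p where p: "p \<in> K"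
    using K(3) unfolding meets_hyperplanes_of_cube_def by blast
  \<comment> \<open>Any coordinate can serve as the height; the \<open>d\<close> others are then
    matched with the index type of the base.\<close>
  obtain t :: 'm where True
    by blast
  have "card (UNIV :: 'n set) = card (- {t})"
    using assms(3,4) by (simp add: Compl_eq_Diff_UNIV)
  then obtain g :: "'n \<Rightarrow> 'm" where "bij_betw g UNIV (- {t})"
    using finite_same_card_bij[of "UNIV :: 'n set" "- {t}"] by auto
  then interpret height_coordinate t g
    by unfold_locales (auto simp: bij_betw_def)
  show ?thesis
    using compact_suspend[OF K(1)] suspend_subset_unit_cube[OF K(2) p]
      meets_hyperplanes_suspend[OF K(2) p K(3)] nowhere_dense_sumset_suspend[OF p K(4)]
    by blast
qed

end
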